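(* Let $G$ be a connected graph of diameter at most $3$. Then the harmonic center $\mathcal{C}_H(G)$ of $G$ is contained in a single block of $G$ (that is, there is a block of $G$ containing all vertices of $\mathcal{C}_H(G)$).
   Context: Graphs are finite, without loops or multiple edges. For a connected graph $G$, $d(u,v)$ denotes the distance (length of a shortest $u$-$v$-path). The harmonic centrality of a vertex $x$ of $G$ is $H_G(x)=\sum_{u\in V(G),\,u\neq x}\frac{1}{d(u,x)}$. The harmonic center $\mathcal{C}_H(G)$ is the subgraph of $G$ induced by the vertices of $G$ with maximum harmonic centrality. A block of $G$ is a maximal connected subgraph of $G$ that has no cut-vertex of its own. *)

theory Defs
  imports "Graph_Theory.Graph_Theory"
begin

text \<open>
  Graphs are symmetric digraphs satisfying the locale predicate \<open>graph\<close>: finite, loop-free, and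
  with exactly one arc in each direction for every edge.
\<close>

text \<open>Meaningful only if \<open>v\<close> is reachable from \<open>u\<close>; otherwise there is no path and \<open>LEAST\<close> is unspecified.\<close>

definition graph_dist :: "('a,'b) pre_digraph \<Rightarrow> 'a \<Rightarrow> 'a \<Rightarrow> nat" where
  "graph_dist G u v = (LEAST n. \<exists>p. pre_digraph.apath G u p v \<and> length p = n)"

definition graph_diameter :: "('a,'b) pre_digraph \<Rightarrow> nat" where
  "graph_diameter G = Max {graph_dist G u v | u v. u \<in> verts G \<and> v \<in> verts G}"

definition harmonic_centrality :: "('a,'b) pre_digraph \<Rightarrow> 'a \<Rightarrow> real" where
  "harmonic_centrality G x = (\<Sum>u\<in>verts G - {x}. 1 / real (graph_dist G u x))"

definition harmonic_center :: "('a,'b) pre_digraph \<Rightarrow> ('a,'b) pre_digraph" where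
  "harmonic_center G =
     G \<restriction> {x \<in> verts G. \<forall>y\<in>verts G. harmonic_centrality G y \<le> harmonic_centrality G x}"

text \<open>
  A cut-vertex separates two other vertices of the same component. In particular, graphs with at
  most two vertices have none, so an isolated vertex or a bridge can be a block.
\<close>

definition cut_vertex :: "('a,'b) pre_digraph \<Rightarrow> 'a \<Rightarrow> bool" where
  "cut_vertex G c \<longleftrightarrow> c \<in> verts G \<and>
     (\<exists>u\<in>verts G - {c}. \<exists>w\<in>verts G - {c}.
        u \<rightarrow>\<^sup>*\<^bsub>G\<^esub> w \<and> \<not> u \<rightarrow>\<^sup>*\<^bsub>pre_digraph.del_vert G c\<^esub> w)"

text \<open>
  The library's \<open>subgraph\<close> admits asymmetric sub-digraphs, so the property being maximised includes
  \<open>graph H\<close>; \<open>connected\<close> includes non-emptiness.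
\<close>

definition block :: "('a,'b) pre_digraph \<Rightarrow> ('a,'b) pre_digraph \<Rightarrow> bool" where
  "block G B \<longleftrightarrow> pre_digraph.max_subgraph G
     (\<lambda>H. graph H \<and> Digraph_Component.connected H \<and> (\<nexists>c. cut_vertex H c)) B"

text \<open>Agreement with the library's weighted distance for unit weights.\<close>

lemma (in wf_digraph) graph_dist_eq_mu:
  assumes "u \<rightarrow>\<^sup>* v"
  shows "ereal (real (graph_dist G u v)) = \<mu> (\<lambda>_. 1) u v"
proof -
  have cost: "awalk_cost (\<lambda>_. 1) p = real (length p)" for p :: "'b awalk"
    by (induction p) (auto simp: awalk_cost_def)
  let ?P = "\<lambda>n. \<exists>p. apath u p v \<and> length p = n"
  from assms obtain p0 where "apath u p0 v"
    by (auto simp: reachable_apath)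
  then have ex: "?P (length p0)" by blast
  then have "?P (graph_dist G u v)"
    unfolding graph_dist_def by (rule LeastI)
  then obtain p where p: "apath u p v" "length p = graph_dist G u v" by blast
  have le: "graph_dist G u v \<le> length q" if "awalk u q v" for q
  proof -
    have ap: "apath u (awalk_to_apath q) v"
      using that by (rule apath_awalk_to_apath)
    then have "graph_dist G u v \<le> length (awalk_to_apath q)"
      unfolding graph_dist_def by (intro Least_le) blast
    also have "\<dots> \<le> length q"
      using awalk_to_path_no_neg_cyc_cost[OF that, of "\<lambda>_. 1"] by (simp add: cost)
    finally show ?thesis .
  qed
  show ?thesis
    unfolding \<mu>_def
  proof (rule INF_eqI[symmetric])
    fix q assume "q \<in> {q. awalk u q v}"
    then show "ereal (real (graph_dist G u v)) \<le> ereal (awalk_cost (\<lambda>_. 1) q)"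
      using le by (simp add: cost)
  next
    fix y assume "\<And>q. q \<in> {q. awalk u q v} \<Longrightarrow> y \<le> ereal (awalk_cost (\<lambda>_. 1) q)"
    from this[of p] p show "y \<le> ereal (real (graph_dist G u v))"
      by (simp add: cost apath_def)
  qed
qed

end

theory Submission
  imports Defs
begin

text \<open>
  Suppose that a vertex \<open>c\<close> separates two vertices \<open>x\<close> and \<open>y\<close> of the harmonic center. Every walk
  between different components of \<open>G - c\<close> passes through \<open>c\<close>, so two vertices in different
  components, each at distance at least \<open>2\<close> from \<open>c\<close>, would be at distance at least \<open>4\<close>. Because
  the diameter is at most \<open>3\<close>, one of the two components consists of neighbours of \<open>c\<close>
  (\<open>separated_side_near\<close>), say the component of \<open>x\<close>. Then \<open>c\<close> is at least as close as \<open>x\<close> to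
  every other vertex: inside that component its distance is \<open>1\<close>, and outside it the way from \<open>x\<close>
  leads through \<open>c\<close>. It is strictly closer to \<open>y\<close>, so \<open>c\<close> has larger harmonic centrality than
  \<open>x\<close> (\<open>harmonic_centrality_less_separator\<close>), which is impossible. Hence no vertex separates two
  vertices of the center.

  It remains to see that a nonempty set of pairwise unseparated vertices lies in a block
  (\<open>inseparable_subset_block\<close>). Enlarge it to a maximal such set \<open>U\<close>. A path between two members
  of \<open>U\<close> stays in \<open>U\<close>, since a vertex on it can escape any deleted vertex towards one of the two
  ends. So the subgraph induced by \<open>U\<close> inherits from \<open>G\<close> all the paths that make it connected and
  free of cut-vertices. It is a maximal subgraph of this kind: the vertices of any other one are
  again pairwise unseparated in \<open>G\<close>, so if it contains \<open>U\<close> its vertex set is \<open>U\<close>, and an induced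
  subgraph already has all the arcs.
\<close>

section \<open>Separation by a vertex\<close>

lemma (in wf_digraph) reachable_del_vert_iff:
  "u \<rightarrow>\<^sup>*\<^bsub>del_vert c\<^esub> w \<longleftrightarrow> (\<exists>p. awalk u p w \<and> c \<notin> set (awalk_verts u p))"
proof
  assume "u \<rightarrow>\<^sup>*\<^bsub>del_vert c\<^esub> w"
  interpret D: wf_digraph "del_vert c" by (rule wf_digraph_del_vert)
  obtain p where p: "D.awalk u p w"
    using \<open>u \<rightarrow>\<^sup>*\<^bsub>del_vert c\<^esub> w\<close> by (auto simp: D.reachable_awalk)
  have "D.awalk_verts u p = awalk_verts u p"
    using fun_cong[OF compatible_awalk_verts[of "del_vert c" G]]
    by (simp add: compatible_def del_vert_simps)
  moreover have "set (D.awalk_verts u p) \<subseteq> verts (del_vert c)"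
    using p by blast
  ultimately have "c \<notin> set (awalk_verts u p)"
    by (auto simp: verts_del_vert)
  then show "\<exists>p. awalk u p w \<and> c \<notin> set (awalk_verts u p)"
    using subgraph_awalk_imp_awalk[OF p subgraph_del_vert] by blast
next
  assume "\<exists>p. awalk u p w \<and> c \<notin> set (awalk_verts u p)"
  then obtain p where p: "awalk u p w" and c: "c \<notin> set (awalk_verts u p)" by blast
  interpret D: wf_digraph "del_vert c" by (rule wf_digraph_del_vert)
  have "D.cas = cas"
    by (rule compatible_cas) (simp add: compatible_def del_vert_simps)
  then have "D.awalk u p w"
    using p c by (auto simp: D.awalk_def awalk_def del_vert_simps set_awalk_verts)
  then show "u \<rightarrow>\<^sup>*\<^bsub>del_vert c\<^esub> w" by (auto simp: D.reachable_awalk)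
qed

lemma reachable_del_vert_mono:
  assumes "subgraph H G" and "u \<rightarrow>\<^sup>*\<^bsub>pre_digraph.del_vert H c\<^esub> w"
  shows "u \<rightarrow>\<^sup>*\<^bsub>pre_digraph.del_vert G c\<^esub> w"
proof -
  interpret H: wf_digraph H using assms(1) by blast
  interpret G: wf_digraph G using assms(1) by blast
  obtain p where p: "H.awalk u p w" "c \<notin> set (H.awalk_verts u p)"
    using assms(2) unfolding H.reachable_del_vert_iff by blast
  have "G.awalk_verts = H.awalk_verts"
    using assms(1) by (intro compatible_awalk_verts) blast
  then have "c \<notin> set (G.awalk_verts u p)" using p(2) by simp
  moreover have "G.awalk u p w" using p(1) assms(1) by (rule G.subgraph_awalk_imp_awalk)
  ultimately show ?thesis unfolding G.reachable_del_vert_iff by blast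
qed

lemma (in graph) reachable_del_vert_sym:
  assumes "u \<rightarrow>\<^sup>*\<^bsub>del_vert c\<^esub> w" shows "w \<rightarrow>\<^sup>*\<^bsub>del_vert c\<^esub> u"
proof (rule symmetric_reachable[OF _ assms])
  show "symmetric (del_vert c)"
    using sym_arcs unfolding symmetric_conv by (fastforce simp: del_vert_simps)
qed

lemma (in wf_digraph) reachable_del_vert_trans:
  assumes "u \<rightarrow>\<^sup>*\<^bsub>del_vert c\<^esub> v" "v \<rightarrow>\<^sup>*\<^bsub>del_vert c\<^esub> w" shows "u \<rightarrow>\<^sup>*\<^bsub>del_vert c\<^esub> w"
proof -
  interpret D: wf_digraph "del_vert c" by (rule wf_digraph_del_vert)
  show ?thesis using assms by (rule D.reachable_trans)
qed

lemma (in graph) connected_iff_reachable: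
  "Digraph_Component.connected G \<longleftrightarrow>
     verts G \<noteq> {} \<and> (\<forall>u\<in>verts G. \<forall>v\<in>verts G. u \<rightarrow>\<^sup>* v)"
  by (simp add: connected_def strongly_connected_def reachable_mk_symmetric_eq[OF sym_arcs])

section \<open>Inseparable vertex sets and blocks\<close>

definition inseparable :: "('a,'b) pre_digraph \<Rightarrow> 'a set \<Rightarrow> bool" where
  "inseparable G U \<longleftrightarrow> U \<subseteq> verts G \<and>
     (\<forall>u\<in>U. \<forall>w\<in>U. \<forall>c\<in>verts G - {u, w}. u \<rightarrow>\<^sup>*\<^bsub>pre_digraph.del_vert G c\<^esub> w)"

text \<open>
  A deleted vertex \<open>c\<close> meets a path at most once, so one of the two pieces into which \<open>v\<close> divides
  the path still joins \<open>v\<close> to a member of \<open>U\<close>, and from there every other member is within reach.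
\<close>

lemma (in graph) inseparable_insert_path_vertex:
  assumes U: "inseparable G U" and uw: "u \<in> U" "w \<in> U"
    and p: "apath u p w" and v: "v \<in> set (awalk_verts u p)"
  shows "inseparable G (insert v U)"
proof -
  have vG: "v \<in> verts G" using p v by (auto simp: apath_def)
  have reach: "v \<rightarrow>\<^sup>*\<^bsub>del_vert c\<^esub> z" if z: "z \<in> U" and c: "c \<in> verts G" "c \<noteq> v" "c \<noteq> z" for c z
  proof -
    obtain q r where qr: "p = q @ r" "awalk u q v" "awalk v r w"
      using awalk_decomp[OF awalkI_apath[OF p] v] by blast
    have "set (awalk_verts u q) \<inter> set (tl (awalk_verts v r)) = {}"
      using p qr by (auto simp: apath_append_iff)
    moreover have "set (awalk_verts v r) \<subseteq> insert v (set (tl (awalk_verts v r)))"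
      using awhd_of_awalk[OF qr(3)] by (cases "awalk_verts v r") auto
    ultimately consider "c \<notin> set (awalk_verts u q)" | "c \<notin> set (awalk_verts v r)"
      using c by blast
    then show ?thesis
    proof cases
      case 1
      then have "u \<rightarrow>\<^sup>*\<^bsub>del_vert c\<^esub> v" "c \<noteq> u"
        using qr hd_in_awalk_verts(1)[OF qr(2)]
        by (auto simp: reachable_del_vert_iff)
      moreover from this have "v \<rightarrow>\<^sup>*\<^bsub>del_vert c\<^esub> u" by (blast intro: reachable_del_vert_sym)
      ultimately show ?thesis
        using U uw z c reachable_del_vert_trans[of c v u z] by (auto simp: inseparable_def)
    next
      case 2
      moreover have "w \<in> set (awalk_verts v r)"
        using awlast_of_awalk[OF qr(3)] last_in_set[OF awalk_verts_non_Nil, of v r]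
        by (metis awalkE qr(3))
      ultimately have "v \<rightarrow>\<^sup>*\<^bsub>del_vert c\<^esub> w" "c \<noteq> w"
        using qr by (auto simp: reachable_del_vert_iff)
      then show ?thesis
        using U uw z c reachable_del_vert_trans[of c v w z] by (auto simp: inseparable_def)
    qed
  qed
  have "v \<rightarrow>\<^sup>*\<^bsub>del_vert c\<^esub> v" if "c \<noteq> v" for c
    using vG that by (auto simp: reachable_del_vert_iff awalk_Nil_iff intro!: exI[of _ "[]"])
  then show ?thesis
    using U vG reach reachable_del_vert_sym unfolding inseparable_def by auto
qed

lemma (in graph) inseparable_verts_subgraph:
  assumes H: "graph H" "Digraph_Component.connected H" "\<nexists>c. cut_vertex H c"
    and sub: "subgraph H G"
  shows "inseparable G (verts H)"
  unfolding inseparable_def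
proof (intro conjI ballI)
  interpret H: graph H by (rule H)
  show "verts H \<subseteq> verts G" using sub by blast
  fix u w c assume A: "u \<in> verts H" "w \<in> verts H" "c \<in> verts G - {u, w}"
  have uw: "u \<rightarrow>\<^sup>*\<^bsub>H\<^esub> w" using H.connected_iff_reachable H A by blast
  have "u \<rightarrow>\<^sup>*\<^bsub>H.del_vert c\<^esub> w"
  proof (cases "c \<in> verts H")
    case True
    then show ?thesis using H(3) A uw by (auto simp: cut_vertex_def)
  next
    case False
    then show ?thesis
      using uw unfolding H.reachable_awalk H.reachable_del_vert_iff by blast
  qed
  then show "u \<rightarrow>\<^sup>*\<^bsub>del_vert c\<^esub> w" by (rule reachable_del_vert_mono[OF sub])
qed

text \<open>
  Maximality of \<open>U\<close> is used twice: it absorbs the inner vertices of every path between members of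
  \<open>U\<close>, and it bounds the vertex sets of the subgraphs that compete for being a block.
\<close>

lemma (in graph) block_induced_maximal_inseparable:
  assumes conn: "Digraph_Component.connected G" and U: "inseparable G U" "U \<noteq> {}"
    and max: "\<And>V. inseparable G V \<Longrightarrow> U \<subseteq> V \<Longrightarrow> V = U"
  shows "block G (G \<restriction> U)"
proof -
  let ?H = "G \<restriction> U"
  have UG: "U \<subseteq> verts G" using U by (simp add: inseparable_def)
  have ind: "induced_subgraph ?H G" using UG by (rule induced_induce)
  interpret H: digraph ?H by (rule digraphI_induced[OF ind])
  interpret H: graph ?H
    using induced_graph_imp_symmetric[OF sym_arcs ind] by (rule H.graphI)
  have path_in_U: "set (awalk_verts u p) \<subseteq> U"
    if "u \<in> U" "w \<in> U" "apath u p w" for u p w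
    using max[OF inseparable_insert_path_vertex[OF U(1) that]] by blast
  have path_H: "H.awalk u p w" if "u \<in> U" "w \<in> U" "apath u p w" for u p w
    using awalk_induce[OF awalkI_apath path_in_U] that by blast
  have "u \<rightarrow>\<^sup>*\<^bsub>?H\<^esub> w" if uw: "u \<in> U" "w \<in> U" for u w
  proof -
    have "u \<rightarrow>\<^sup>* w" using conn UG uw by (auto simp: connected_iff_reachable)
    then show ?thesis using path_H uw by (auto simp: reachable_apath H.reachable_awalk)
  qed
  then have conn_H: "Digraph_Component.connected ?H"
    using U(2) by (simp add: H.connected_iff_reachable)
  have "u \<rightarrow>\<^sup>*\<^bsub>H.del_vert c\<^esub> w" if uwc: "u \<in> U - {c}" "w \<in> U - {c}" "c \<in> U" for u w c
  proof -
    have "u \<rightarrow>\<^sup>*\<^bsub>del_vert c\<^esub> w" using U(1) uwc by (auto simp: inseparable_def)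
    then obtain p where p: "awalk u p w" "c \<notin> set (awalk_verts u p)"
      by (auto simp: reachable_del_vert_iff)
    \<comment> \<open>Only paths are known to stay in \<open>U\<close>, so the walk has to lose its cycles first.\<close>
    let ?q = "awalk_to_apath p"
    have q: "apath u ?q w" using p(1) by (rule apath_awalk_to_apath)
    have "set (awalk_verts u ?q) \<subseteq> set (awalk_verts u p)"
      using awalk_to_apath_subset[OF p(1)] set_awalk_verts[OF p(1)]
        set_awalk_verts[OF awalkI_apath[OF q]] by auto
    then have "c \<notin> set (H.awalk_verts u ?q)"
      using p(2) by (auto simp: awalk_verts_induce)
    then show ?thesis
      using path_H[OF _ _ q] uwc by (auto simp: H.reachable_del_vert_iff)
  qed
  then have no_cut: "\<nexists>c. cut_vertex ?H c" by (auto simp: cut_vertex_def)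
  show ?thesis
    unfolding block_def
  proof (rule max_subgraphI)
    show "graph ?H \<and> Digraph_Component.connected ?H \<and> (\<nexists>c. cut_vertex ?H c)"
      using H.graph_axioms conn_H no_cut by blast
    show "subgraph ?H G" using ind by blast
    fix K assume K: "?H \<noteq> K" "subgraph ?H K" "subgraph K G"
    show "\<not> (graph K \<and> Digraph_Component.connected K \<and> (\<nexists>c. cut_vertex K c))"
    proof
      assume "graph K \<and> Digraph_Component.connected K \<and> (\<nexists>c. cut_vertex K c)"
      then have "inseparable G (verts K)" using K(3) inseparable_verts_subgraph by blast
      moreover have "U \<subseteq> verts K" using subgraph_imp_subverts[OF K(2)] by simp
      ultimately have vK: "verts K = U" by (rule max)
      have "subgraph K ?H" using subgraph_induce_subgraphI2[OF K(3)] vK by simp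
      then have "K = ?H"
        using K(2) vK by (intro pre_digraph.equality) (auto simp: subgraph_def compatible_def)
      then show False using K(1) by simp
    qed
  qed
qed

lemma (in graph) inseparable_subset_block:
  assumes conn: "Digraph_Component.connected G" and S: "inseparable G S" "S \<noteq> {}"
  shows "\<exists>B. block G B \<and> S \<subseteq> verts B"
proof -
  have "finite {V. inseparable G V}"
    by (rule finite_subset[of _ "Pow (verts G)"]) (auto simp: inseparable_def)
  then obtain U where U: "inseparable G U" "S \<subseteq> U"
    and max: "\<And>V. inseparable G V \<Longrightarrow> U \<subseteq> V \<Longrightarrow> V = U"
    using finite_has_maximal2[of "{V. inseparable G V}" S] S(1) by auto
  have "block G (G \<restriction> U)"
    using block_induced_maximal_inseparable[OF conn U(1) _ max] U(2) S(2) by blast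
  then show ?thesis using U(2) by (intro exI[of _ "G \<restriction> U"]) simp
qed

section \<open>Distances across a separating vertex\<close>

context wf_digraph
begin

lemma obtain_shortest_awalk:
  assumes "u \<rightarrow>\<^sup>* v"
  obtains p where "awalk u p v" "length p = graph_dist G u v"
proof -
  have "\<exists>n p. apath u p v \<and> length p = n"
    using assms by (auto simp: reachable_apath)
  then have "\<exists>p. apath u p v \<and> length p = graph_dist G u v"
    unfolding graph_dist_def by (rule LeastI_ex)
  then show thesis using that by (auto simp: apath_def)
qed

lemma graph_dist_le_length:
  assumes "awalk u p v"
  shows "graph_dist G u v \<le> length p"
proof -
  have "u \<rightarrow>\<^sup>* v" using assms ..
  have "awalk_cost (\<lambda>_. 1) p = real (length p)" for p :: "'b awalk"
    by (induction p) (auto simp: awalk_cost_def)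
  moreover have "\<mu> (\<lambda>_. 1) u v \<le> ereal (awalk_cost (\<lambda>_. 1) p)"
    using assms by (rule min_cost_le_walk_cost)
  ultimately show ?thesis
    by (simp add: graph_dist_eq_mu[OF \<open>u \<rightarrow>\<^sup>* v\<close>, symmetric])
qed

lemma graph_dist_pos:
  assumes "u \<rightarrow>\<^sup>* v" "u \<noteq> v"
  shows "1 \<le> graph_dist G u v"
proof -
  obtain p where p: "awalk u p v" "length p = graph_dist G u v"
    using assms(1) by (rule obtain_shortest_awalk)
  then have "p \<noteq> []" using assms(2) by (auto simp: awalk_Nil_iff)
  then show ?thesis using p(2) by (cases p) auto
qed

lemma graph_dist_via_separator:
  assumes "u \<rightarrow>\<^sup>* v" "\<not> u \<rightarrow>\<^sup>*\<^bsub>del_vert c\<^esub> v"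
  shows "graph_dist G u c + graph_dist G c v \<le> graph_dist G u v"
proof -
  obtain p where p: "awalk u p v" "length p = graph_dist G u v"
    using assms(1) by (rule obtain_shortest_awalk)
  then have "c \<in> set (awalk_verts u p)"
    using assms(2) by (auto simp: reachable_del_vert_iff)
  then obtain q r where qr: "p = q @ r" "awalk u q c" "awalk c r v"
    using awalk_decomp[OF p(1)] by blast
  then show ?thesis
    using graph_dist_le_length[OF qr(2)] graph_dist_le_length[OF qr(3)] p(2) by simp
qed

end

lemma (in fin_digraph) graph_dist_le_diameter:
  assumes "u \<in> verts G" "v \<in> verts G"
  shows "graph_dist G u v \<le> graph_diameter G"
  unfolding graph_diameter_def
proof (rule Max_ge)
  have "{graph_dist G u v |u v. u \<in> verts G \<and> v \<in> verts G} =
      (\<lambda>(u, v). graph_dist G u v) ` (verts G \<times> verts G)" by auto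
  then show "finite {graph_dist G u v |u v. u \<in> verts G \<and> v \<in> verts G}" by simp
qed (use assms in blast)

lemma (in graph) awalk_reverse:
  assumes "awalk u p v"
  shows "\<exists>q. awalk v q u \<and> length q = length p"
  using assms
proof (induction p arbitrary: u)
  case Nil
  then show ?case by (auto simp: awalk_Nil_iff)
next
  case (Cons e p)
  then have e: "e \<in> arcs G" "tail G e = u" and "awalk (head G e) p v"
    by (auto simp: awalk_Cons_iff)
  then obtain q where q: "awalk v q (head G e)" "length q = length p"
    using Cons.IH by blast
  obtain e' where e': "e' \<in> arcs G" "tail G e' = head G e" "head G e' = u"
    using sym_arcs e unfolding symmetric_conv by metis
  have "awalk v (q @ [e']) u"
    using awalk_appendI[OF q(1)] arc_implies_awalk[OF e'(1)] e' by simp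
  then show ?case using q(2) by (intro exI[of _ "q @ [e']"]) simp
qed

lemma (in graph) graph_dist_sym:
  assumes "u \<rightarrow>\<^sup>* v"
  shows "graph_dist G u v = graph_dist G v u"
proof -
  have "graph_dist G b a \<le> graph_dist G a b" if "a \<rightarrow>\<^sup>* b" for a b
    using obtain_shortest_awalk[OF that] awalk_reverse graph_dist_le_length by metis
  then show ?thesis using assms symmetric_reachable' by (meson le_antisym)
qed

text \<open>
  Otherwise there are vertices on both sides at distance at least \<open>2\<close> from \<open>c\<close>, and a shortest
  walk between them, which visits \<open>c\<close>, has length at least \<open>4\<close>.
\<close>

lemma (in graph) separated_side_near:
  assumes conn: "Digraph_Component.connected G" and diam: "graph_diameter G \<le> 3"
    and c: "c \<in> verts G" and sep: "\<not> x \<rightarrow>\<^sup>*\<^bsub>del_vert c\<^esub> y"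
  shows "(\<forall>a. a \<rightarrow>\<^sup>*\<^bsub>del_vert c\<^esub> x \<longrightarrow> graph_dist G a c \<le> 1) \<or>
         (\<forall>b. b \<rightarrow>\<^sup>*\<^bsub>del_vert c\<^esub> y \<longrightarrow> graph_dist G b c \<le> 1)"
proof (rule ccontr)
  assume "\<not> ?thesis"
  then obtain a b where a: "a \<rightarrow>\<^sup>*\<^bsub>del_vert c\<^esub> x" "graph_dist G a c \<ge> 2"
    and b: "b \<rightarrow>\<^sup>*\<^bsub>del_vert c\<^esub> y" "graph_dist G b c \<ge> 2"
    by fastforce
  have "\<not> a \<rightarrow>\<^sup>*\<^bsub>del_vert c\<^esub> b"
    using sep a(1) b(1) reachable_del_vert_sym reachable_del_vert_trans by blast
  moreover have ab: "a \<in> verts G" "b \<in> verts G"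
    using a(1) b(1) by (auto simp: reachable_del_vert_iff)
  then have reach: "a \<rightarrow>\<^sup>* b" "b \<rightarrow>\<^sup>* c"
    using conn c by (auto simp: connected_iff_reachable)
  ultimately have "graph_dist G a c + graph_dist G c b \<le> graph_dist G a b"
    by (intro graph_dist_via_separator)
  also have "\<dots> \<le> 3"
    using graph_dist_le_diameter[OF ab] diam by simp
  finally show False
    using a(2) b(2) graph_dist_sym[OF reach(2)] by simp
qed

section \<open>The harmonic center\<close>

text \<open>
  The sums for \<open>c\<close> and \<open>x\<close> are compared term by term: over the vertices other than both of them, and
  for the vertex \<open>x\<close> in the one sum against the vertex \<open>c\<close> in the other. The vertex \<open>y\<close> makes
  the inequality strict.
\<close>

lemma (in graph) harmonic_centrality_less_separator:
  assumes conn: "Digraph_Component.connected G"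
    and V: "x \<in> verts G" "y \<in> verts G" "c \<in> verts G" "x \<noteq> c" "y \<noteq> c"
    and sep: "\<not> x \<rightarrow>\<^sup>*\<^bsub>del_vert c\<^esub> y"
    and near: "\<And>a. a \<rightarrow>\<^sup>*\<^bsub>del_vert c\<^esub> x \<Longrightarrow> graph_dist G a c \<le> 1"
  shows "harmonic_centrality G x < harmonic_centrality G c"
proof -
  let ?R = "verts G - {c, x}"
  have reach: "u \<rightarrow>\<^sup>* v" if "u \<in> verts G" "v \<in> verts G" for u v
    using conn that by (auto simp: connected_iff_reachable)
  have refl: "x \<rightarrow>\<^sup>*\<^bsub>del_vert c\<^esub> x"
    using V by (auto simp: reachable_del_vert_iff awalk_Nil_iff intro!: exI[of _ "[]"])
  have via: "graph_dist G u c < graph_dist G u x"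
    if "u \<in> ?R" "\<not> u \<rightarrow>\<^sup>*\<^bsub>del_vert c\<^esub> x" for u
    using graph_dist_via_separator[of u x c] graph_dist_pos[of c x] reach V that by simp
  have pos: "1 \<le> graph_dist G u c" if "u \<in> ?R" for u
    using graph_dist_pos reach V that by simp
  have le: "graph_dist G u c \<le> graph_dist G u x" if "u \<in> ?R" for u
  proof (cases "u \<rightarrow>\<^sup>*\<^bsub>del_vert c\<^esub> x")
    case True
    then show ?thesis using near[of u] graph_dist_pos[of u x] reach V that by fastforce
  next
    case False
    then show ?thesis using via[OF that] by simp
  qed
  have y: "y \<in> ?R" "\<not> y \<rightarrow>\<^sup>*\<^bsub>del_vert c\<^esub> x"
    using V sep refl reachable_del_vert_sym by blast+
  have rest: "(\<Sum>u\<in>?R. 1 / real (graph_dist G u x)) < (\<Sum>u\<in>?R. 1 / real (graph_dist G u c))"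
  proof (rule sum_strict_mono_ex1)
    show "\<forall>u\<in>?R. 1 / real (graph_dist G u x) \<le> 1 / real (graph_dist G u c)"
      using le pos by (fastforce intro!: divide_left_mono)
    show "\<exists>u\<in>?R. 1 / real (graph_dist G u x) < 1 / real (graph_dist G u c)"
      using y via[OF y] pos[OF y(1)] by (intro bexI[of _ y]) (auto intro!: divide_strict_left_mono)
  qed simp
  have "graph_dist G x c = 1"
    using near[OF refl] graph_dist_pos[of x c] reach V by simp
  moreover have "1 \<le> graph_dist G c x"
    using graph_dist_pos[of c x] reach V by simp
  ultimately have ends: "1 / real (graph_dist G c x) \<le> 1 / real (graph_dist G x c)"
    by simp
  have split: "verts G - {x} = insert c ?R" "verts G - {c} = insert x ?R"
    using V by auto
  have "harmonic_centrality G x =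
      1 / real (graph_dist G c x) + (\<Sum>u\<in>?R. 1 / real (graph_dist G u x))"
    unfolding harmonic_centrality_def split(1) by (rule sum.insert) auto
  moreover have "harmonic_centrality G c =
      1 / real (graph_dist G x c) + (\<Sum>u\<in>?R. 1 / real (graph_dist G u c))"
    unfolding harmonic_centrality_def split(2) by (rule sum.insert) auto
  ultimately show ?thesis using rest ends by linarith
qed

lemma (in graph) harmonic_center_inseparable:
  assumes conn: "Digraph_Component.connected G" and diam: "graph_diameter G \<le> 3"
  shows "inseparable G (verts (harmonic_center G))"
proof -
  have "x \<rightarrow>\<^sup>*\<^bsub>del_vert c\<^esub> y"
    if xy: "x \<in> verts (harmonic_center G)" "y \<in> verts (harmonic_center G)"
      and c: "c \<in> verts G - {x, y}" for x y c
  proof (rule ccontr)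
    assume sep: "\<not> x \<rightarrow>\<^sup>*\<^bsub>del_vert c\<^esub> y"
    have V: "x \<in> verts G" "y \<in> verts G"
      and max: "harmonic_centrality G c \<le> harmonic_centrality G x"
        "harmonic_centrality G c \<le> harmonic_centrality G y"
      using xy c by (auto simp: harmonic_center_def)
    have sep': "\<not> y \<rightarrow>\<^sup>*\<^bsub>del_vert c\<^esub> x"
      using sep reachable_del_vert_sym by blast
    have "harmonic_centrality G x < harmonic_centrality G c \<or>
          harmonic_centrality G y < harmonic_centrality G c"
      using separated_side_near[OF conn diam _ sep] c
        harmonic_centrality_less_separator[OF conn V _ _ _ sep]
        harmonic_centrality_less_separator[OF conn V(2,1) _ _ _ sep'] by blast
    then show False using max by simp
  qed
  then show ?thesis by (auto simp: inseparable_def harmonic_center_def)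
qed

lemma (in graph) harmonic_center_nonempty:
  assumes "verts G \<noteq> {}"
  shows "verts (harmonic_center G) \<noteq> {}"
proof -
  let ?M = "Max (harmonic_centrality G ` verts G)"
  have "?M \<in> harmonic_centrality G ` verts G"
    using assms by (intro Max_in) auto
  then obtain x where x: "x \<in> verts G" "harmonic_centrality G x = ?M" by force
  have "harmonic_centrality G y \<le> harmonic_centrality G x" if "y \<in> verts G" for y
    unfolding x(2) using that by simp
  then have "x \<in> verts (harmonic_center G)"
    using x(1) by (simp add: harmonic_center_def)
  then show ?thesis by blast
qed

theorem theorem4:
  fixes G :: "('a, 'b) pre_digraph"
  assumes "graph G"
    and "Digraph_Component.connected G"
    and "graph_diameter G \<le> 3"
  shows "\<exists>B. block G B \<and> verts (harmonic_center G) \<subseteq> verts B"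
proof -
  interpret graph G by fact
  have "verts (harmonic_center G) \<noteq> {}"
    using assms(2) by (intro harmonic_center_nonempty) (simp add: connected_iff_reachable)
  then show ?thesis
    using inseparable_subset_block harmonic_center_inseparable assms(2,3) by blast
qed

end
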